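(* Let $(J_n)_{n\ge 0}$ and $(JL_n)_{n\ge 0}$ be the Jacobsthal and Jacobsthal-Lucas numbers, and for $n\ge 0$ let $$HSJ_n=\begin{bmatrix} J_n+jJ_{n+3}\\ -J_{n+1}+jJ_{n+2}\end{bmatrix},\qquad HSJL_n=\begin{bmatrix} JL_n+jJL_{n+3}\\ -JL_{n+1}+jJL_{n+2}\end{bmatrix}.$$ Then for all $n\ge 1$, $$JL_n\,HSJ_n+2\,JL_{n-1}\,HSJ_{n-1}=HSJL_{2n-1},$$ where $JL_n\,HSJ_n$ denotes the spinor $HSJ_n$ multiplied by the real scalar $JL_n$.
   Context: The Jacobsthal numbers: $J_0=0$, $J_1=1$, $J_{n+2}=J_{n+1}+2J_n$. The Jacobsthal-Lucas numbers: $JL_0=2$, $JL_1=1$, $JL_{n+2}=JL_{n+1}+2JL_n$. Here $j$ is the hyperbolic unit ($j^2=1$, $j\neq\pm1$); spinors are column vectors with two hyperbolic-number entries, added and multiplied by real scalars componentwise. *)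

theory Defs
  imports "HOL-Analysis.Cartesian_Space"
begin

fun jacobsthal :: "nat \<Rightarrow> nat" where
  "jacobsthal 0 = 0"
| "jacobsthal (Suc 0) = 1"
| "jacobsthal (Suc (Suc n)) = jacobsthal (Suc n) + 2 * jacobsthal n"

fun jacobsthal_lucas :: "nat \<Rightarrow> nat" where
  "jacobsthal_lucas 0 = 2"
| "jacobsthal_lucas (Suc 0) = 1"
| "jacobsthal_lucas (Suc (Suc n)) = jacobsthal_lucas (Suc n) + 2 * jacobsthal_lucas n"

text \<open>\<open>Hyperbolic a b\<close> is the hyperbolic (split-complex) number \<open>a + j b\<close>.\<close>

datatype hyperbolic = Hyperbolic (hre: real) (him: real)

lemma hyperbolic_eq_iff: "x = y \<longleftrightarrow> hre x = hre y \<and> him x = him y"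
  by (cases x; cases y) simp

instantiation hyperbolic :: real_algebra_1
begin

definition zero_hyperbolic where "0 = Hyperbolic 0 0"
definition one_hyperbolic where "1 = Hyperbolic 1 0"
definition plus_hyperbolic where
  "x + y = Hyperbolic (hre x + hre y) (him x + him y)"
definition uminus_hyperbolic where "- x = Hyperbolic (- hre x) (- him x)"
definition minus_hyperbolic where
  "x - y = Hyperbolic (hre x - hre y) (him x - him y)"
definition times_hyperbolic where
  "x * y = Hyperbolic (hre x * hre y + him x * him y) (hre x * him y + him x * hre y)"
definition scaleR_hyperbolic where
  "r *\<^sub>R x = Hyperbolic (r * hre x) (r * him x)"

lemmas hyperbolic_defs = zero_hyperbolic_def one_hyperbolic_def plus_hyperbolic_def
  uminus_hyperbolic_def minus_hyperbolic_def times_hyperbolic_def scaleR_hyperbolic_def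

instance
  by standard (simp_all add: hyperbolic_defs hyperbolic_eq_iff algebra_simps)

end

instance hyperbolic :: comm_ring_1
  by standard (simp_all add: hyperbolic_defs hyperbolic_eq_iff algebra_simps)

definition hyp_j :: hyperbolic where
  "hyp_j = Hyperbolic 0 1"

lemma hyp_j_square: "hyp_j ^ 2 = 1"
  by (simp add: hyp_j_def power2_eq_square hyperbolic_defs)

lemma hyp_j_neq: "hyp_j \<noteq> 1" "hyp_j \<noteq> - 1"
  by (simp_all add: hyp_j_def hyperbolic_defs)

lemma Hyperbolic_eq: "Hyperbolic a b = of_real a + hyp_j * of_real b"
  by (simp add: hyp_j_def of_real_def hyperbolic_defs)

type_synonym hyp_spinor = "hyperbolic ^ 2"

definition HSJ :: "nat \<Rightarrow> hyp_spinor" where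
  "HSJ n = vector
    [of_nat (jacobsthal n) + hyp_j * of_nat (jacobsthal (n + 3)),
     - of_nat (jacobsthal (n + 1)) + hyp_j * of_nat (jacobsthal (n + 2))]"

definition HSJL :: "nat \<Rightarrow> hyp_spinor" where
  "HSJL n = vector
    [of_nat (jacobsthal_lucas n) + hyp_j * of_nat (jacobsthal_lucas (n + 3)),
     - of_nat (jacobsthal_lucas (n + 1)) + hyp_j * of_nat (jacobsthal_lucas (n + 2))]"

end

theory Submission
  imports Defs
begin

(* For scalar and vector solutions f, x of the same recurrence y(n+2) = p y(n+1) + q y(n), the
   combination f(m+1) x(k+1) + q f(m) x(k) depends only on m + k, so it can be evaluated at m = 0.
   For f = JL and x = HSJ (p = 1, q = 2) its value at m = 0, k = s is HSJ(s+1) + 4 HSJ(s), which is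
   HSJL(s+1) because JL(s+1) = J(s+1) + 4 J(s).  The theorem is the diagonal case m = k. *)

lemma (in module) second_order_recurrence_convolution:
  assumes f: "\<And>n. f (Suc (Suc n)) = p * f (Suc n) + q * f n"
    and x: "\<And>n. x (Suc (Suc n)) = scale p (x (Suc n)) + scale q (x n)"
  shows "scale (f (Suc m)) (x (Suc k)) + scale (q * f m) (x k)
    = scale (f 1) (x (Suc (m + k))) + scale (q * f 0) (x (m + k))"
proof (induction m arbitrary: k)
  case 0
  show ?case by simp
next
  case (Suc m)
  have "scale (f (Suc (Suc m))) (x (Suc k)) + scale (q * f (Suc m)) (x k)
      = scale (f (Suc m)) (scale p (x (Suc k)) + scale q (x k)) + scale (q * f m) (x (Suc k))"
    by (simp add: f algebra_simps)
  also have "\<dots> = scale (f (Suc m)) (x (Suc (Suc k))) + scale (q * f m) (x (Suc k))"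
    by (simp only: x)
  also have "\<dots> = scale (f 1) (x (Suc (Suc m + k))) + scale (q * f 0) (x (Suc m + k))"
    using Suc.IH[of "Suc k"] by simp
  finally show ?case .
qed

lemma jacobsthal_lucas_Suc:
  "jacobsthal_lucas (Suc n) = jacobsthal (Suc n) + 4 * jacobsthal n"
  by (induction n rule: jacobsthal.induct) simp_all

lemma HSJ_Suc_Suc: "HSJ (Suc (Suc n)) = HSJ (Suc n) + 2 *\<^sub>R HSJ n"
  by (simp add: HSJ_def vec_eq_iff forall_2 scaleR_conv_of_real algebra_simps numeral_eq_Suc)

lemma HSJL_Suc: "HSJL (Suc n) = HSJ (Suc n) + 4 *\<^sub>R HSJ n"
  by (simp add: HSJ_def HSJL_def jacobsthal_lucas_Suc vec_eq_iff forall_2 scaleR_conv_of_real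
      algebra_simps numeral_eq_Suc del: jacobsthal.simps jacobsthal_lucas.simps)

lemma jacobsthal_lucas_HSJ_convolution:
  "real (jacobsthal_lucas (Suc m)) *\<^sub>R HSJ (Suc k)
      + (2 * real (jacobsthal_lucas m)) *\<^sub>R HSJ k
    = HSJL (Suc (m + k))"
  (is "?convolution = _")
proof -
  have "?convolution = real (jacobsthal_lucas 1) *\<^sub>R HSJ (Suc (m + k))
      + (2 * real (jacobsthal_lucas 0)) *\<^sub>R HSJ (m + k)"
    by (rule real_vector.second_order_recurrence_convolution[where p = 1])
      (simp_all add: HSJ_Suc_Suc)
  also have "\<dots> = HSJL (Suc (m + k))"
    by (simp add: HSJL_Suc)
  finally show ?thesis .
qed

theorem theorem3p14:
  fixes n :: nat
  assumes "n \<ge> 1"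
  shows "real (jacobsthal_lucas n) *\<^sub>R HSJ n
           + (2 * real (jacobsthal_lucas (n - 1))) *\<^sub>R HSJ (n - 1)
         = HSJL (2 * n - 1)"
proof -
  obtain m where n: "n = Suc m"
    using assms by (cases n) auto
  then have "n - 1 = m" and "2 * n - 1 = Suc (m + m)"
    by simp_all
  then show ?thesis
    using jacobsthal_lucas_HSJ_convolution[of m m] by (simp only: n)
qed

end
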